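(* For $n\ge1$ let $C_n(x,y,z)=\sum_{\sigma\in Q_n}x^{\mathrm{des}(\sigma)}y^{\mathrm{asc}(\sigma)}z^{\mathrm{plat}(\sigma)}$. Then $C_n(x,y,z)$ can be written as $$C_n(x,y,z)=\sum_{i+2j+3k=2n+1}\gamma_{n,i,j,k}\,(x+y+z)^i(xy+xz+yz)^j(xyz)^k,$$ where, for nonnegative integers $i,j,k$ with $i+2j+3k=2n+1$, the coefficient $\gamma_{n,i,j,k}$ equals the number of 0-1-2-3 increasing plane trees on $[n]$ with $k$ leaves, $j$ vertices of degree one and $i$ vertices of degree two. In particular $C_n(x,y,z)$ is $e$-positive.
   Context: For $n\ge1$, a Stirling permutation of the multiset $\{1,1,2,2,\dots,n,n\}$ is a word $\sigma=\sigma_1\cdots\sigma_{2n}$ using each $j\in[n]$ exactly twice such that for every $j$ all entries between the two occurrences of $j$ are greater than $j$; $Q_n$ is the set of such permutations. Set $\sigma_0=\sigma_{2n+1}=0$. An index $1\le i\le 2n$ is a descent if $\sigma_i>\sigma_{i+1}$, an ascent if $\sigma_{i-1}<\sigma_i$, and a plateau if $\sigma_i=\sigma_{i+1}$; $\mathrm{des},\mathrm{asc},\mathrm{plat}$ count these. An increasing plane tree on $[n]$ is a rooted plane (children ordered) tree with vertex set $[n]$ whose labels increase along every path from the root; it is a 0-1-2-3 increasing plane tree if every vertex has at most three children. The degree of a vertex is its number of children; a leaf has degree zero. A symmetric polynomial is $e$-positive if it is a polynomial with nonnegative coefficients in the elementary symmetric functions. *)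

theory Defs
  imports
    "HOL-Library.Poly_Mapping"
    "HOL-Combinatorics.Permutations"
begin

section \<open>Multivariate polynomials\<close>

text \<open>
  A monomial is a finitely supported exponent function and a polynomial is a finitely supported
  coefficient function on monomials; \<^theory>\<open>HOL-Library.Poly_Mapping\<close> provides the
  convolution product, so \<open>int mpoly\<close> is the polynomial ring over the integers in countably many
  variables.
\<close>

type_synonym 'a mpoly = "(nat \<Rightarrow>\<^sub>0 nat) \<Rightarrow>\<^sub>0 'a"

definition const :: "'a::zero \<Rightarrow> 'a mpoly" where
  "const c = Poly_Mapping.single 0 c"

definition var :: "nat \<Rightarrow> int mpoly" where
  "var i = Poly_Mapping.single (Poly_Mapping.single i 1) 1"

definition in_vars :: "nat set \<Rightarrow> int mpoly \<Rightarrow> bool" where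
  "in_vars V p \<longleftrightarrow> (\<forall>m \<in> Poly_Mapping.keys p. Poly_Mapping.keys m \<subseteq> V)"

definition subst_vars :: "(nat \<Rightarrow> int mpoly) \<Rightarrow> int mpoly \<Rightarrow> int mpoly" where
  "subst_vars f p =
     (\<Sum>m \<in> Poly_Mapping.keys p. const (Poly_Mapping.lookup p m) *
        (\<Prod>i \<in> Poly_Mapping.keys m. f i ^ Poly_Mapping.lookup m i))"

definition symmetric_poly :: "nat \<Rightarrow> int mpoly \<Rightarrow> bool" where
  "symmetric_poly r p \<longleftrightarrow>
     in_vars {1..r} p \<and>
     (\<forall>\<pi>. \<pi> permutes {1..r} \<longrightarrow> subst_vars (\<lambda>i. var (\<pi> i)) p = p)"

definition elem_sym :: "nat \<Rightarrow> nat \<Rightarrow> int mpoly" where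
  "elem_sym r k = (\<Sum>S \<in> {S. S \<subseteq> {1..r} \<and> card S = k}. \<Prod>i\<in>S. var i)"

text \<open>
  In the witness \<open>q\<close> the \<open>k\<close>-th variable stands for the \<open>k\<close>-th elementary symmetric polynomial
  in \<open>r\<close> variables.
\<close>

definition e_positive :: "nat \<Rightarrow> int mpoly \<Rightarrow> bool" where
  "e_positive r p \<longleftrightarrow>
     symmetric_poly r p \<and>
     (\<exists>q. in_vars {1..r} q \<and> (\<forall>m. Poly_Mapping.lookup q m \<ge> 0) \<and>
          p = subst_vars (elem_sym r) q)"


section \<open>Stirling permutations\<close>

definition stirling_perms :: "nat \<Rightarrow> nat list set" where
  "stirling_perms n =
     {w. set w \<subseteq> {1..n} \<and> (\<forall>j\<in>{1..n}. count_list w j = 2) \<and>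
         (\<forall>a b c. a < b \<and> b < c \<and> c < length w \<and> w ! a = w ! c \<longrightarrow> w ! b > w ! a)}"

text \<open>\<open>padded w ! i\<close> is the \<open>i\<close>-th letter, counted from 1, with the boundary convention
  that the letters at positions \<open>0\<close> and \<open>length w + 1\<close> are \<open>0\<close>.\<close>

definition padded :: "nat list \<Rightarrow> nat list" where
  "padded w = 0 # w @ [0]"

definition des :: "nat list \<Rightarrow> nat" where
  "des w = card {i \<in> {1..length w}. padded w ! i > padded w ! (i + 1)}"

definition asc :: "nat list \<Rightarrow> nat" where
  "asc w = card {i \<in> {1..length w}. padded w ! (i - 1) < padded w ! i}"

definition plat :: "nat list \<Rightarrow> nat" where
  "plat w = card {i \<in> {1..length w}. padded w ! i = padded w ! (i + 1)}"

abbreviation var_x :: "int mpoly" where "var_x \<equiv> var 1"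
abbreviation var_y :: "int mpoly" where "var_y \<equiv> var 2"
abbreviation var_z :: "int mpoly" where "var_z \<equiv> var 3"

definition stirling_poly :: "nat \<Rightarrow> int mpoly" where
  "stirling_poly n = (\<Sum>w \<in> stirling_perms n. var_x ^ des w * var_y ^ asc w * var_z ^ plat w)"


section \<open>Increasing plane trees\<close>

datatype plane_tree = Node (root_label: nat) (children: "plane_tree list")

fun labels :: "plane_tree \<Rightarrow> nat list" where
  "labels (Node a ts) = a # concat (map labels ts)"

text \<open>The numbers of children of the vertices, one entry per vertex.\<close>

fun degrees :: "plane_tree \<Rightarrow> nat list" where
  "degrees (Node a ts) = length ts # concat (map degrees ts)"

fun increasing :: "plane_tree \<Rightarrow> bool" where
  "increasing (Node a ts) \<longleftrightarrow> (\<forall>t \<in> set ts. a < root_label t \<and> increasing t)"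

definition increasing_plane_trees :: "nat \<Rightarrow> plane_tree set" where
  "increasing_plane_trees n =
     {t. distinct (labels t) \<and> set (labels t) = {1..n} \<and> increasing t}"

definition trees_0123 :: "nat \<Rightarrow> plane_tree set" where
  "trees_0123 n = {t \<in> increasing_plane_trees n. \<forall>d \<in> set (degrees t). d \<le> 3}"

definition gamma :: "nat \<Rightarrow> nat \<Rightarrow> nat \<Rightarrow> nat \<Rightarrow> nat" where
  "gamma n i j k =
     card {t \<in> trees_0123 n. count_list (degrees t) 0 = k \<and>
             count_list (degrees t) 1 = j \<and> count_list (degrees t) 2 = i}"

end

theory Submission
  imports Defs "HOL-Library.Sublist"
begin

text \<open>
  Let \<open>D = xyz (\<partial>\<^sub>x + \<partial>\<^sub>y + \<partial>\<^sub>z)\<close>. Inserting the pair \<open>(n+1)(n+1)\<close> into a gap of a Stirling permutation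
  turns the ascent, descent or plateau at this gap into one ascent, one plateau and one descent,
  so \<open>C\<^sub>n\<^sub>+\<^sub>1 = D C\<^sub>n\<close>. Give a vertex of degree \<open>d\<close> the weight \<open>c\<^sub>d = e\<^sub>3\<^sub>-\<^sub>d(x, y, z)\<close>, which is \<open>0\<close> for
  \<open>d > 3\<close>, and a tree the product of the weights of its vertices. A new leaf can be attached to a
  vertex of degree \<open>d\<close> in \<open>d + 1\<close> ways, and \<open>D c\<^sub>d = (d + 1) c\<^sub>d\<^sub>+\<^sub>1 c\<^sub>0\<close>; hence the total weight of the
  increasing plane trees satisfies the same recursion with the same initial value \<open>xyz\<close>.
\<close>

section \<open>Substitution and elementary symmetric polynomials\<close>

text \<open>An integer polynomial is an element of the free abelian group on the monomials:
  \<open>frag_of m\<close> is the monomial \<open>m\<close>, and \<open>frag_extend\<close> extends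
  a map on monomials linearly. Both substitution and D are defined in this way below.\<close>

lemma frag_cmul_conv_const: "frag_cmul c p = const c * p"
  unfolding const_def mult_map_scale_conv_mult[symmetric]
  by (rule poly_mapping_eqI) (simp add: Poly_Mapping.map.rep_eq when_def)

lemma frag_of_add: "frag_of (m + m' :: nat \<Rightarrow>\<^sub>0 nat) = frag_of m * frag_of m'"
  by (simp add: mult_single)

text \<open>Differences of monomials generate all integer polynomials, so scalar multiples need no
  case of their own.\<close>

lemma mpoly_induct [case_names zero one diff]:
  fixes p :: "int mpoly"
  assumes "P 0" "\<And>m. P (frag_of m)" "\<And>p q. P p \<Longrightarrow> P q \<Longrightarrow> P (p - q)"
  shows "P p"
  by (rule frag_induction[where S = UNIV and P = P]) (use assms in auto)

lemma frag_extend_mult: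
  fixes F :: "(nat \<Rightarrow>\<^sub>0 nat) \<Rightarrow> int mpoly"
  assumes "\<And>m m'. F (m + m') = F m * F m'"
  shows "frag_extend F (p * q) = frag_extend F p * frag_extend F q"
proof (induction p rule: mpoly_induct)
  case (one m)
  show ?case
    by (induction q rule: mpoly_induct)
      (simp_all add: assms frag_extend_diff algebra_simps flip: frag_of_add)
qed (simp_all add: frag_extend_diff algebra_simps)

lemma subst_vars_conv_frag_extend:
  "subst_vars f = frag_extend (\<lambda>m. \<Prod>i \<in> Poly_Mapping.keys m. f i ^ Poly_Mapping.lookup m i)"
  by (simp add: subst_vars_def frag_extend_def frag_cmul_conv_const fun_eq_iff)

text \<open>Indices outside the support contribute factors f^0 = 1. The freedom in \<open>A\<close>
  allows the products for \<open>m\<close>, \<open>m'\<close> and \<open>m + m'\<close> to be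
  compared over one common index set.\<close>

lemma subst_vars_frag_of:
  assumes "finite A" "Poly_Mapping.keys m \<subseteq> A"
  shows "subst_vars f (frag_of m) = (\<Prod>i\<in>A. f i ^ Poly_Mapping.lookup m i)"
  unfolding subst_vars_conv_frag_extend frag_extend_of
  using assms by (intro prod.mono_neutral_left) (auto simp: in_keys_iff)

lemma subst_vars_0 [simp]: "subst_vars f 0 = 0"
  and subst_vars_add [simp]: "subst_vars f (p + q) = subst_vars f p + subst_vars f q"
  and subst_vars_diff [simp]: "subst_vars f (p - q) = subst_vars f p - subst_vars f q"
  by (simp_all add: subst_vars_conv_frag_extend frag_extend_add frag_extend_diff)

lemma subst_vars_1 [simp]: "subst_vars f 1 = 1"
  using subst_vars_frag_of[of "{}" 0 f] by simp

lemma subst_vars_mult [simp]: "subst_vars f (p * q) = subst_vars f p * subst_vars f q"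
  unfolding subst_vars_conv_frag_extend
proof (rule frag_extend_mult)
  fix m m' :: "nat \<Rightarrow>\<^sub>0 nat"
  let ?A = "Poly_Mapping.keys m \<union> Poly_Mapping.keys m'"
  have *: "(\<Prod>i \<in> Poly_Mapping.keys k. f i ^ Poly_Mapping.lookup k i) = (\<Prod>i\<in>?A. f i ^ Poly_Mapping.lookup k i)"
    if "Poly_Mapping.keys k \<subseteq> ?A" for k
    using subst_vars_frag_of[of "Poly_Mapping.keys k" k f] subst_vars_frag_of[of ?A k f] that by simp
  show "(\<Prod>i \<in> Poly_Mapping.keys (m + m'). f i ^ Poly_Mapping.lookup (m + m') i) =
    (\<Prod>i \<in> Poly_Mapping.keys m. f i ^ Poly_Mapping.lookup m i) *
    (\<Prod>i \<in> Poly_Mapping.keys m'. f i ^ Poly_Mapping.lookup m' i)"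
    by (subst *[OF keys_add])
      (simp only: *[OF Un_upper1] *[OF Un_upper2] lookup_add power_add prod.distrib)
qed

lemma subst_vars_var [simp]: "subst_vars f (var i) = f i"
  using subst_vars_frag_of[of "{i}" "Poly_Mapping.single i 1" f] by (simp add: var_def)

lemma subst_vars_sum [simp]: "subst_vars f (\<Sum>i\<in>A. p i) = (\<Sum>i\<in>A. subst_vars f (p i))"
  by (induction A rule: infinite_finite_induct) simp_all

lemma subst_vars_prod [simp]: "subst_vars f (\<Prod>i\<in>A. p i) = (\<Prod>i\<in>A. subst_vars f (p i))"
  by (induction A rule: infinite_finite_induct) simp_all

lemma subst_vars_power [simp]: "subst_vars f (p ^ k) = subst_vars f p ^ k"
  by (induction k) simp_all

lemma subst_vars_of_nat [simp]: "subst_vars f (of_nat k) = of_nat k"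
  by (induction k) simp_all

lemma subst_vars_subst_vars: "subst_vars f (subst_vars g p) = subst_vars (\<lambda>i. subst_vars f (g i)) p"
proof (induction p rule: mpoly_induct)
  case (one m)
  then show ?case
    using subst_vars_frag_of[of "Poly_Mapping.keys m" m] by simp
qed simp_all

section \<open>Variables occurring in a polynomial, and symmetry\<close>

lemma in_vars_0 [simp]: "in_vars V 0" and in_vars_1 [simp]: "in_vars V 1"
  by (simp_all add: in_vars_def)

lemma in_vars_single: "Poly_Mapping.keys m \<subseteq> V \<Longrightarrow> in_vars V (Poly_Mapping.single m c)"
  by (simp add: in_vars_def)

lemma in_vars_add: "in_vars V p \<Longrightarrow> in_vars V q \<Longrightarrow> in_vars V (p + q)"
  unfolding in_vars_def using keys_add[of p q] by blast

lemma in_vars_mult: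
  assumes "in_vars V p" "in_vars V q"
  shows "in_vars V (p * q)"
  unfolding in_vars_def
proof
  fix m assume "m \<in> Poly_Mapping.keys (p * q)"
  then obtain a b where "m = a + b" "a \<in> Poly_Mapping.keys p" "b \<in> Poly_Mapping.keys q"
    using keys_mult[of p q] by blast
  then show "Poly_Mapping.keys m \<subseteq> V"
    using assms keys_add[of a b] unfolding in_vars_def by blast
qed

lemma in_vars_sum: "(\<And>i. i \<in> A \<Longrightarrow> in_vars V (p i)) \<Longrightarrow> in_vars V (\<Sum>i\<in>A. p i)"
  by (induction A rule: infinite_finite_induct) (simp_all add: in_vars_add)

lemma in_vars_prod: "(\<And>i. i \<in> A \<Longrightarrow> in_vars V (p i)) \<Longrightarrow> in_vars V (\<Prod>i\<in>A. p i)"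
  by (induction A rule: infinite_finite_induct) (simp_all add: in_vars_mult)

lemma in_vars_power: "in_vars V p \<Longrightarrow> in_vars V (p ^ k)"
  by (induction k) (simp_all add: in_vars_mult)

lemma in_vars_subst_vars:
  assumes "in_vars V p" "\<And>i. i \<in> V \<Longrightarrow> in_vars W (f i)"
  shows "in_vars W (subst_vars f p)"
  unfolding subst_vars_def
proof (intro in_vars_sum in_vars_mult in_vars_prod in_vars_power)
  show "in_vars W (const (Poly_Mapping.lookup p m))" for m
    unfolding const_def by (rule in_vars_single) simp
next
  show "in_vars W (f i)" if "m \<in> Poly_Mapping.keys p" "i \<in> Poly_Mapping.keys m" for m i
    using that assms unfolding in_vars_def[of V] by blast
qed

lemma in_vars_elem_sym: "in_vars {1..r} (elem_sym r k)"
  unfolding elem_sym_def var_def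
  by (intro in_vars_sum in_vars_prod in_vars_single) auto

text \<open>A permutation of the variables merely permutes the k-subsets that index the sum.\<close>

lemma subst_vars_elem_sym:
  assumes "\<pi> permutes {1..r}"
  shows "subst_vars (\<lambda>i. var (\<pi> i)) (elem_sym r k) = elem_sym r k"
proof -
  let ?F = "{S. S \<subseteq> {1..r} \<and> card S = k}"
  have inj: "inj_on \<pi> S" for S
    using permutes_inj[OF assms] by (rule inj_on_subset) simp
  have bij: "bij_betw ((`) \<pi>) ?F ?F"
  proof (rule bij_betw_byWitness[where f' = "(`) (inv \<pi>)"])
    have "inv \<pi> permutes {1..r}"
      by (rule permutes_inv[OF assms])
    moreover have "\<sigma> ` S \<in> ?F" if "\<sigma> permutes {1..r}" "S \<in> ?F" for \<sigma> S
      using that permutes_image[OF that(1)] permutes_inj[OF that(1)]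
      by (auto simp: card_image inj_on_subset)
    ultimately show "(`) \<pi> ` ?F \<subseteq> ?F" "(`) (inv \<pi>) ` ?F \<subseteq> ?F"
      using assms by blast+
  qed (simp_all add: image_image permutes_inverses[OF assms])
  have "subst_vars (\<lambda>i. var (\<pi> i)) (elem_sym r k) = (\<Sum>S\<in>?F. \<Prod>i\<in>\<pi> ` S. var i)"
    by (simp add: elem_sym_def prod.reindex[OF inj])
  also have "\<dots> = elem_sym r k"
    unfolding elem_sym_def by (rule sum.reindex_bij_betw[OF bij])
  finally show ?thesis .
qed

text \<open>Symmetry comes for free: permuting variables in a polynomial in the elementary symmetric
  polynomials fixes each of these, by composition of substitutions.\<close>

lemma e_positiveI:
  assumes "in_vars {1..r} q" "\<And>m. Poly_Mapping.lookup q m \<ge> 0"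
  shows "e_positive r (subst_vars (elem_sym r) q)"
  unfolding e_positive_def symmetric_poly_def
proof (intro conjI allI impI exI[of _ q])
  show "in_vars {1..r} (subst_vars (elem_sym r) q)"
    by (rule in_vars_subst_vars[OF assms(1) in_vars_elem_sym])
qed (use assms in \<open>simp_all add: subst_vars_subst_vars subst_vars_elem_sym\<close>)

lemma elem_sym_3:
  "elem_sym 3 1 = var_x + var_y + var_z"
  "elem_sym 3 2 = var_x * var_y + var_x * var_z + var_y * var_z"
  "elem_sym 3 3 = var_x * var_y * var_z"
proof -
  have Pow: "{S. S \<subseteq> {1..3} \<and> card S = k} = {S \<in> Pow {1,2,3::nat}. card S = k}" for k
    by (auto simp: numeral_3_eq_3 atLeastAtMostSuc_conv)
  have "{S. S \<subseteq> {1..3} \<and> card S = 1} = {{1},{2},{3::nat}}"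
    "{S. S \<subseteq> {1..3} \<and> card S = 2} = {{1,2},{1,3},{2,3::nat}}"
    "{S. S \<subseteq> {1..3} \<and> card S = 3} = {{1,2,3::nat}}"
    unfolding Pow by (auto simp: Pow_insert)
  then show "elem_sym 3 1 = var_x + var_y + var_z"
    "elem_sym 3 2 = var_x * var_y + var_x * var_z + var_y * var_z"
    "elem_sym 3 3 = var_x * var_y * var_z"
    by (simp_all add: elem_sym_def doubleton_eq_iff ac_simps)
qed

section \<open>The derivation\<close>

text \<open>As \<open>D x\<^sub>i = xyz\<close> for the three variables, a monomial is multiplied by the sum of \<open>m\<^sub>i xyz / x\<^sub>i\<close>;
  this form makes the product rule immediate.\<close>

definition stirling_deriv :: "int mpoly \<Rightarrow> int mpoly" where
  "stirling_deriv = frag_extend (\<lambda>m. frag_of m *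
     (of_nat (Poly_Mapping.lookup m 1) * (var_y * var_z) +
      of_nat (Poly_Mapping.lookup m 2) * (var_x * var_z) +
      of_nat (Poly_Mapping.lookup m 3) * (var_x * var_y)))"

lemma stirling_deriv_0 [simp]: "stirling_deriv 0 = 0"
  and stirling_deriv_add [simp]: "stirling_deriv (p + q) = stirling_deriv p + stirling_deriv q"
  and stirling_deriv_diff [simp]: "stirling_deriv (p - q) = stirling_deriv p - stirling_deriv q"
  by (simp_all add: stirling_deriv_def frag_extend_add frag_extend_diff)

lemma stirling_deriv_mult [simp]:
  "stirling_deriv (p * q) = stirling_deriv p * q + p * stirling_deriv q"
proof (induction p rule: mpoly_induct)
  case (one m)
  show ?case
  proof (induction q rule: mpoly_induct)
    case (one m')
    show ?case
      unfolding frag_of_add[symmetric] stirling_deriv_def frag_extend_of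
      by (simp add: frag_of_add lookup_add algebra_simps)
  qed (simp_all add: algebra_simps)
qed (simp_all add: algebra_simps)

lemma stirling_deriv_1 [simp]: "stirling_deriv 1 = 0"
  using stirling_deriv_mult[of 1 1] by simp

lemma stirling_deriv_sum: "stirling_deriv (\<Sum>i\<in>A. p i) = (\<Sum>i\<in>A. stirling_deriv (p i))"
  by (induction A rule: infinite_finite_induct) simp_all

lemma stirling_deriv_var:
  "i \<in> {1,2,3} \<Longrightarrow> stirling_deriv (var i) = var_x * var_y * var_z"
proof -
  have v: "var i = frag_of (Poly_Mapping.single i 1)"
    by (simp add: var_def)
  have "stirling_deriv (var i) = var i * 
     (of_nat (Poly_Mapping.lookup (Poly_Mapping.single i 1) 1) * (var_y * var_z) +
      of_nat (Poly_Mapping.lookup (Poly_Mapping.single i 1) 2) * (var_x * var_z) +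
      of_nat (Poly_Mapping.lookup (Poly_Mapping.single i 1) 3) * (var_x * var_y))"
    unfolding v stirling_deriv_def frag_extend_of by (rule refl)
  then show "i \<in> {1,2,3} \<Longrightarrow> stirling_deriv (var i) = var_x * var_y * var_z"
    by (auto simp: lookup_single)
qed

section \<open>Stirling permutations\<close>

lemma subseq_Cons_iff_drop:
  "subseq (x # xs) w \<longleftrightarrow> (\<exists>i<length w. w ! i = x \<and> subseq xs (drop (Suc i) w))"
proof
  assume "subseq (x # xs) w"
  then obtain us vs where "w = us @ x # vs" "subseq xs vs"
    by (auto dest: list_emb_ConsD)
  then show "\<exists>i<length w. w ! i = x \<and> subseq xs (drop (Suc i) w)"
    by (intro exI[of _ "length us"]) auto
next
  assume "\<exists>i<length w. w ! i = x \<and> subseq xs (drop (Suc i) w)"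
  then show "subseq (x # xs) w"
    by (metis id_take_nth_drop list_emb_append2 subseq_Cons2)
qed

text \<open>The condition on positions becomes one on subsequences a b a. Such conditions pass to
  subwords, which makes inserting and deleting a pair of letters manageable without index
  arithmetic.\<close>

lemma stirling_perms_iff:
  "w \<in> stirling_perms n \<longleftrightarrow> set w \<subseteq> {1..n} \<and> (\<forall>j\<in>{1..n}. count_list w j = 2) \<and>
     (\<forall>a b. subseq [a, b, a] w \<longrightarrow> a < b)"
proof -
  have "(\<exists>i j k. i < j \<and> j < k \<and> k < length w \<and> w ! i = a \<and> w ! j = b \<and> w ! k = a) \<longleftrightarrow> subseq [a, b, a] w"
    (is "?L \<longleftrightarrow> ?R") for a b
  proof
    assume ?L
    then obtain i j k where "i < j" "j < k" "k < length w" "w ! i = a" "w ! j = b" "w ! k = a"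
      by blast
    then show ?R
      by (subst subseq_Cons_iff_drop, intro exI[of _ i] conjI;
          (subst subseq_Cons_iff_drop, intro exI[of _ "j - Suc i"] conjI)?;
          (subst subseq_Cons_iff_drop, intro exI[of _ "k - Suc j"] conjI)?) auto
  next
    assume ?R
    then obtain i j k where "i < length w" "w ! i = a" "j < length (drop (Suc i) w)" "drop (Suc i) w ! j = b"
      "k < length (drop (Suc j) (drop (Suc i) w))" "drop (Suc j) (drop (Suc i) w) ! k = a"
      unfolding subseq_Cons_iff_drop by blast
    then show ?L
      by (intro exI[of _ i] exI[of _ "Suc i + j"] exI[of _ "Suc i + Suc j + k"]) (auto simp: add_ac)
  qed
  moreover have "(\<forall>i j k. i < j \<and> j < k \<and> k < length w \<and> w ! i = w ! k \<longrightarrow> w ! j > w ! i) \<longleftrightarrow>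
    (\<forall>a b. (\<exists>i j k. i < j \<and> j < k \<and> k < length w \<and> w ! i = a \<and> w ! j = b \<and> w ! k = a) \<longrightarrow> a < b)"
    (is "?P \<longleftrightarrow> ?Q")
  proof
    assume ?P
    then show ?Q by metis
  next
    assume Q: ?Q
    show ?P
    proof (intro allI impI)
      fix i j k assume "i < j \<and> j < k \<and> k < length w \<and> w ! i = w ! k"
      with Q[rule_format, of "w ! i" "w ! j"] show "w ! i < w ! j" by metis
    qed
  qed
  ultimately show ?thesis
    unfolding stirling_perms_def by simp
qed

section \<open>Inserting the pair of largest letters\<close>

definition insert_pair :: "nat \<Rightarrow> nat \<Rightarrow> nat list \<Rightarrow> nat list" where
  "insert_pair m k w = take k w @ [m, m] @ drop k w"

lemma stirling_perms_not_in_set: "w \<in> stirling_perms n \<Longrightarrow> n < m \<Longrightarrow> m \<notin> set w"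
  by (auto simp: stirling_perms_def)

lemma subseq_Cons_append_notin: "x \<notin> set p \<Longrightarrow> subseq (x # xs) (p @ ys) \<longleftrightarrow> subseq (x # xs) ys"
  by (induction p) auto

lemma insert_pair_in_stirling_perms:
  assumes w: "w \<in> stirling_perms n"
  shows "insert_pair (Suc n) k w \<in> stirling_perms (Suc n)"
proof -
  define p r where "p = take k w" and "r = drop k w"
  have w_eq: "w = p @ r"
    by (simp add: p_def r_def)
  have notin: "Suc n \<notin> set p" "Suc n \<notin> set r"
    using stirling_perms_not_in_set[OF w, of "Suc n"] by (auto simp: w_eq)
  have set: "set p \<union> set r \<subseteq> {1..n}" and cnt: "\<forall>j\<in>{1..n}. count_list p j + count_list r j = 2"
    and less: "\<And>a b. subseq [a, b, a] (p @ r) \<Longrightarrow> a < b"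
    using w unfolding w_eq stirling_perms_iff by auto
  let ?v = "p @ [Suc n, Suc n] @ r"
  have "a < b" if ss: "subseq [a, b, a] ?v" for a b
  proof (cases "a = Suc n")
    case False
    show ?thesis
    proof (cases "b = Suc n")
      case True
      have "a \<in> set ?v"
        using list_emb_set[OF ss, of a] by auto
      with set True False show ?thesis by auto
    next
      case b: False
      \<comment> \<open>The pattern avoids the new letter, so erasing that letter leaves an
        occurrence in the old word.\<close>
      have "subseq (filter (\<lambda>x. x \<noteq> Suc n) [a, b, a]) (filter (\<lambda>x. x \<noteq> Suc n) ?v)"
        using ss by (rule subseq_filter)
      moreover have "filter (\<lambda>x. x \<noteq> Suc n) p = p" "filter (\<lambda>x. x \<noteq> Suc n) r = r"
        using notin by (auto intro!: filter_True)
      ultimately show ?thesis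
        using False b less by simp
    qed
  next
    case True
    \<comment> \<open>The first letter of the pattern can be matched with the first new letter. The
      two copies are adjacent, so b a then needs a third copy, in \<open>r\<close>.\<close>
    have "subseq [b, a] (Suc n # r)"
      using ss notin by (simp add: True subseq_Cons_append_notin)
    then have "Suc n \<in> set r"
      by (cases "b = Suc n") (auto simp: True subseq_singleton_left dest: list_emb_set[where x = "Suc n"])
    with notin show ?thesis by simp
  qed
  moreover have "set ?v \<subseteq> {1..Suc n}"
    using set by auto
  moreover have "\<forall>j\<in>{1..Suc n}. count_list ?v j = 2"
    using cnt notin by (auto simp: le_Suc_eq count_notin)
  ultimately show ?thesis
    unfolding insert_pair_def p_def[symmetric] r_def[symmetric] stirling_perms_iff by blast
qed

lemma stirling_perms_Suc_cases:
  assumes v: "v \<in> stirling_perms (Suc n)"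
  obtains w k where "w \<in> stirling_perms n" "k \<le> length w" "v = insert_pair (Suc n) k w"
proof -
  have set: "set v \<subseteq> {1..Suc n}" and cnt: "\<And>j. j \<in> {1..Suc n} \<Longrightarrow> count_list v j = 2"
    and less: "\<And>a b. subseq [a, b, a] v \<Longrightarrow> a < b"
    using v unfolding stirling_perms_iff by auto
  have cnt_n: "count_list v (Suc n) = 2"
    using cnt by simp
  then have "Suc n \<in> set v"
    by (metis count_notin zero_neq_numeral)
  then obtain p s where ps: "v = p @ Suc n # s" "Suc n \<notin> set p"
    by (meson split_list_first)
  then have s: "count_list s (Suc n) = 1"
    using cnt_n by (simp add: count_notin)
  then have "Suc n \<in> set s"
    by (metis count_notin zero_neq_one)
  then obtain q r where qr: "s = q @ Suc n # r" "Suc n \<notin> set q"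
    by (meson split_list_first)
  have r: "Suc n \<notin> set r"
    using s by (simp add: qr count_notin count_list_0_iff)
  \<comment> \<open>A letter between the two copies of the maximum would have to exceed the
    maximum.\<close>
  have "q = []"
  proof (rule ccontr)
    assume "q \<noteq> []"
    then obtain b q' where q: "q = b # q'"
      by (cases q) auto
    have "subseq [Suc n, b, Suc n] v"
      by (auto simp: ps qr q subseq_singleton_left intro!: list_emb_append2)
    then have "Suc n < b" by (rule less)
    moreover have "b \<le> Suc n"
      using set by (auto simp: ps qr q)
    ultimately show False by simp
  qed
  then have v_eq: "v = p @ Suc n # Suc n # r"
    by (simp add: ps qr)
  have "p @ r \<in> stirling_perms n"
    unfolding stirling_perms_iff
  proof (intro conjI ballI allI impI)
    have "set (p @ r) \<subseteq> {1..Suc n} - {Suc n}"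
      using set ps r by (auto simp: v_eq)
    then show "set (p @ r) \<subseteq> {1..n}"
      by (auto simp: le_Suc_eq)
    show "count_list (p @ r) j = 2" if "j \<in> {1..n}" for j
      using cnt[of j] that by (auto simp: v_eq)
    have "subseq (p @ r) v"
      by (simp add: v_eq subseq_append' list_emb_Cons)
    then show "a < b" if "subseq [a, b, a] (p @ r)" for a b
      using that less subseq_order.trans by blast
  qed
  moreover have "v = insert_pair (Suc n) (length p) (p @ r)"
    by (simp add: insert_pair_def v_eq)
  ultimately show thesis
    using that[of "p @ r" "length p"] by simp
qed

lemma insert_pair_inject:
  assumes "insert_pair m k w = insert_pair m k' w'" "m \<notin> set w" "m \<notin> set w'" "k \<le> length w" "k' \<le> length w'"
  shows "w = w' \<and> k = k'"
proof -
  \<comment> \<open>Erasing \<open>m\<close> recovers the word, and the length of the part before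
    the first \<open>m\<close> recovers the gap.\<close>
  have *: "w = filter (\<lambda>x. x \<noteq> m) (insert_pair m k w)" "k = length (takeWhile (\<lambda>x. x \<noteq> m) (insert_pair m k w))"
    if "m \<notin> set w" "k \<le> length w" for k w
  proof -
    have "m \<notin> set (take k w)" "m \<notin> set (drop k w)"
      using that by (auto dest: in_set_takeD in_set_dropD)
    then have "filter (\<lambda>x. x \<noteq> m) (take k w) = take k w" "filter (\<lambda>x. x \<noteq> m) (drop k w) = drop k w"
      "takeWhile (\<lambda>x. x \<noteq> m) (take k w @ m # m # drop k w) = take k w"
      by (auto intro!: filter_True simp: takeWhile_append)
    then show "w = filter (\<lambda>x. x \<noteq> m) (insert_pair m k w)" "k = length (takeWhile (\<lambda>x. x \<noteq> m) (insert_pair m k w))"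
      using that by (simp_all add: insert_pair_def)
  qed
  show ?thesis
    using *[of w k] *[of w' k'] assms by metis
qed

lemma bij_betw_insert_pair:
  "bij_betw (\<lambda>(w, k). insert_pair (Suc n) k w) (SIGMA w:stirling_perms n. {..length w}) (stirling_perms (Suc n))"
  unfolding bij_betw_def
proof
  show "inj_on (\<lambda>(w, k). insert_pair (Suc n) k w) (SIGMA w:stirling_perms n. {..length w})"
    by (auto simp: inj_on_def dest!: insert_pair_inject simp: stirling_perms_not_in_set)
  show "(\<lambda>(w, k). insert_pair (Suc n) k w) ` (SIGMA w:stirling_perms n. {..length w}) = stirling_perms (Suc n)"
    by (force intro: insert_pair_in_stirling_perms elim: stirling_perms_Suc_cases)
qed

lemma stirling_perms_0: "stirling_perms 0 = {[]}"
  by (auto simp: stirling_perms_def)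

lemma stirling_perms_1: "stirling_perms (Suc 0) = {[1, 1]}"
proof -
  have "(SIGMA w:{[]::nat list}. {..length w}) = {([], 0)}"
    by auto
  then show ?thesis
    using bij_betw_imp_surj_on[OF bij_betw_insert_pair[of 0]]
    by (simp add: stirling_perms_0 insert_pair_def)
qed

lemma finite_stirling_perms: "finite (stirling_perms n)"
proof (induction n)
  case (Suc n)
  then show ?case
    using bij_betw_finite[OF bij_betw_insert_pair[of n]] by auto
qed (simp add: stirling_perms_0)

section \<open>Weights of words and the recursion for the Stirling polynomials\<close>

definition step_weight :: "nat \<Rightarrow> nat \<Rightarrow> int mpoly" where
  "step_weight a b = (if a < b then var_y else if b < a then var_x else var_z)"

fun path_weight :: "nat list \<Rightarrow> int mpoly" where
  "path_weight (a # b # l) = step_weight a b * path_weight (b # l)"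
| "path_weight _ = 1"

lemma path_weight_conv_prod: "path_weight l = (\<Prod>i<length l - 1. step_weight (l ! i) (l ! Suc i))"
  by (induction l rule: path_weight.induct) (simp_all add: prod.lessThan_Suc_shift del: prod.lessThan_Suc)

text \<open>The padded word has one step more than \<open>w\<close> has letters. The first step
  leaves 0, so it is an ascent, and the last returns to 0, so it is a descent. Hence
  \<open>asc\<close> loses nothing by ignoring the last step, and \<open>des\<close> and
  \<open>plat\<close> lose nothing by ignoring the first.\<close>

lemma path_weight_padded:
  assumes "w \<noteq> []" "0 \<notin> set w"
  shows "path_weight (padded w) = var_x ^ des w * var_y ^ asc w * var_z ^ plat w"
proof -
  define L where "L = padded w"
  define N where "N = length w"
  let ?A = "{..<Suc N}"
  let ?U = "{i. L ! i < L ! Suc i}" and ?D = "{i. L ! Suc i < L ! i}"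
  have L: "L ! 0 = 0" "L ! Suc N = 0" "L ! Suc 0 \<noteq> 0"
    using assms by (cases w; auto simp: L_def N_def padded_def nth_append)+
  have "path_weight L = (\<Prod>i\<in>?A. step_weight (L ! i) (L ! Suc i))"
    by (simp add: path_weight_conv_prod L_def padded_def N_def)
  also have "\<dots> = var_y ^ card (?A \<inter> ?U) * (var_x ^ card (?A \<inter> - ?U \<inter> ?D) * var_z ^ card (?A \<inter> - ?U \<inter> - ?D))"
    by (simp add: step_weight_def prod.If_cases del: prod.lessThan_Suc)
  also have "card (?A \<inter> ?U) = asc w"
  proof -
    \<comment> \<open>Ascents are indexed by the right end of a step, and steps by their left end;
      hence the shift by one.\<close>
    have "{i \<in> {1..N}. L ! (i - 1) < L ! i} = Suc ` (?A \<inter> ?U)"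
    proof (intro equalityI subsetI)
      fix i assume "i \<in> {i \<in> {1..N}. L ! (i - 1) < L ! i}"
      then show "i \<in> Suc ` (?A \<inter> ?U)"
        by (intro image_eqI[of _ _ "i - 1"]) auto
    next
      fix i assume "i \<in> Suc ` (?A \<inter> ?U)"
      then show "i \<in> {i \<in> {1..N}. L ! (i - 1) < L ! i}"
        using L by (auto simp: less_Suc_eq)
    qed
    then show ?thesis
      by (simp add: asc_def L_def N_def card_image)
  qed
  also have "?A \<inter> - ?U \<inter> ?D = {i \<in> {1..N}. L ! i > L ! (i + 1)}"
    using L by (auto simp: Suc_le_eq intro: gr0I)
  also have "card \<dots> = des w"
    by (simp add: des_def L_def N_def)
  also have "?A \<inter> - ?U \<inter> - ?D = {i \<in> {1..N}. L ! i = L ! (i + 1)}"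
    using L by (auto simp: Suc_le_eq intro: gr0I)
  also have "card \<dots> = plat w"
    by (simp add: plat_def L_def N_def)
  finally show ?thesis
    by (simp add: L_def mult_ac)
qed

text \<open>Inserting \<open>m\<close> twice between neighbours a and b replaces one factor x, y or
  z by y * z * x, which is D of that factor. Summing over all gaps is the product rule.\<close>

lemma sum_path_weight_insert:
  assumes "\<forall>a\<in>set l. a < m"
  shows "(\<Sum>k<length l - 1. path_weight (take (Suc k) l @ [m, m] @ drop (Suc k) l)) =
    stirling_deriv (path_weight l)"
  using assms
proof (induction l rule: path_weight.induct)
  case (1 a b l)
  have *: "stirling_deriv (step_weight a b) = step_weight a m * step_weight m m * step_weight m b"
    using 1 by (simp add: step_weight_def stirling_deriv_var mult_ac)
  show ?case
    using 1 by (simp add: sum.lessThan_Suc_shift * mult.assoc del: sum.lessThan_Suc flip: sum_distrib_left)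
qed simp_all

lemma stirling_poly_conv_path_weight:
  assumes "n \<ge> 1"
  shows "stirling_poly n = (\<Sum>w\<in>stirling_perms n. path_weight (padded w))"
  unfolding stirling_poly_def
proof (intro sum.cong refl path_weight_padded[symmetric])
  fix w assume w: "w \<in> stirling_perms n"
  then have "count_list w 1 = 2"
    using assms by (auto simp: stirling_perms_def)
  then show "w \<noteq> []" by auto
  show "0 \<notin> set w"
    using w by (auto simp: stirling_perms_def)
qed

lemma stirling_poly_1: "stirling_poly (Suc 0) = var_x * var_y * var_z"
  by (simp add: stirling_poly_conv_path_weight stirling_perms_1 padded_def step_weight_def mult_ac)

lemma stirling_poly_Suc:
  assumes "n \<ge> 1"
  shows "stirling_poly (Suc n) = stirling_deriv (stirling_poly n)"
proof -
  have "stirling_poly (Suc n) =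
    (\<Sum>(w, k)\<in>(SIGMA w:stirling_perms n. {..length w}). path_weight (padded (insert_pair (Suc n) k w)))"
    by (simp add: stirling_poly_conv_path_weight case_prod_unfold flip: sum.reindex_bij_betw[OF bij_betw_insert_pair])
  also have "\<dots> = (\<Sum>w\<in>stirling_perms n. \<Sum>k\<le>length w. path_weight (padded (insert_pair (Suc n) k w)))"
    by (rule sum.Sigma[symmetric]) (auto simp: finite_stirling_perms)
  also have "\<dots> = (\<Sum>w\<in>stirling_perms n. stirling_deriv (path_weight (padded w)))"
  proof (rule sum.cong[OF refl])
    fix w assume w: "w \<in> stirling_perms n"
    \<comment> \<open>The leading 0 moves the cut from \<open>k\<close> to \<open>Suc k\<close>; the
      gaps of \<open>w\<close>, both ends included, are then the inner gaps of the padded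
      word.\<close>
    have "padded (insert_pair (Suc n) k w) = take (Suc k) (padded w) @ [Suc n, Suc n] @ drop (Suc k) (padded w)"
      if "k \<le> length w" for k
      using that by (simp add: padded_def insert_pair_def)
    then have "(\<Sum>k\<le>length w. path_weight (padded (insert_pair (Suc n) k w))) =
      (\<Sum>k<length (padded w) - 1. path_weight (take (Suc k) (padded w) @ [Suc n, Suc n] @ drop (Suc k) (padded w)))"
      by (intro sum.cong) (auto simp: padded_def)
    also have "\<dots> = stirling_deriv (path_weight (padded w))"
      using w by (intro sum_path_weight_insert) (auto simp: padded_def stirling_perms_def)
    finally show "(\<Sum>k\<le>length w. path_weight (padded (insert_pair (Suc n) k w))) =
      stirling_deriv (path_weight (padded w))" .
  qed
  finally show ?thesis
    using assms by (simp add: stirling_poly_conv_path_weight stirling_deriv_sum)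
qed

section \<open>Increasing plane trees\<close>

text \<open>In a forest the new leaf goes in front of the first tree, inside it, or further right,
  so each insertion arises once. Lists let the sum of weights follow this recursion; that their
  entries differ is shown in \<open>distinct_add_leaf\<close>.\<close>

fun add_leaf :: "nat \<Rightarrow> plane_tree \<Rightarrow> plane_tree list"
  and add_leaf_forest :: "nat \<Rightarrow> plane_tree list \<Rightarrow> plane_tree list list" where
  "add_leaf m (Node a ts) = map (Node a) (add_leaf_forest m ts)"
| "add_leaf_forest m [] = [[Node m []]]"
| "add_leaf_forest m (t # ts) =
     (Node m [] # t # ts) # map (\<lambda>t'. t' # ts) (add_leaf m t) @ map ((#) t) (add_leaf_forest m ts)"

text \<open>Whole subtrees with root \<open>m\<close> are dropped. In an increasing tree whose
  largest label is \<open>m\<close>, such a subtree is a single leaf.\<close>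

fun del_leaf :: "nat \<Rightarrow> plane_tree \<Rightarrow> plane_tree"
  and del_leaf_forest :: "nat \<Rightarrow> plane_tree list \<Rightarrow> plane_tree list" where
  "del_leaf m (Node a ts) = Node a (del_leaf_forest m ts)"
| "del_leaf_forest m [] = []"
| "del_leaf_forest m (t # ts) =
     (if root_label t = m then del_leaf_forest m ts else del_leaf m t # del_leaf_forest m ts)"

lemma root_label_in_labels [simp]: "root_label t \<in> set (labels t)"
  by (cases t) simp

lemma labels_neq_Nil [simp]: "labels t \<noteq> []"
  by (cases t) simp

lemma root_label_add_leaf: "t' \<in> set (add_leaf m t) \<Longrightarrow> root_label t' = root_label t"
  by (cases t) auto

lemma mset_labels_add_leaf:
  "t' \<in> set (add_leaf m t) \<Longrightarrow> mset (labels t') = add_mset m (mset (labels t))"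
  "us \<in> set (add_leaf_forest m ts) \<Longrightarrow>
     mset (concat (map labels us)) = add_mset m (mset (concat (map labels ts)))"
  by (induction m t and m ts arbitrary: t' and us rule: add_leaf_add_leaf_forest.induct) auto

text \<open>In the forest version \<open>b\<close> plays the label of the common parent;
  \<open>b < m\<close> makes the new leaf admissible directly below it.\<close>

lemma increasing_add_leaf_iff:
  "t' \<in> set (add_leaf m t) \<Longrightarrow> \<forall>a\<in>set (labels t). a < m \<Longrightarrow> increasing t' \<longleftrightarrow> increasing t"
  "us \<in> set (add_leaf_forest m ts) \<Longrightarrow> \<forall>a\<in>set (concat (map labels ts)). a < m \<Longrightarrow> b < m \<Longrightarrow>
     (\<forall>t\<in>set us. b < root_label t \<and> increasing t) \<longleftrightarrow> (\<forall>t\<in>set ts. b < root_label t \<and> increasing t)"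
proof (induction m t and m ts arbitrary: t' and us b rule: add_leaf_add_leaf_forest.induct)
  case (3 m t ts)
  from 3(3) consider "us = Node m [] # t # ts" | t' where "us = t' # ts" "t' \<in> set (add_leaf m t)"
    | vs where "us = t # vs" "vs \<in> set (add_leaf_forest m ts)"
    by auto
  then show ?case
  proof cases
    case 1
    with 3(5) show ?thesis by simp
  next
    case 2
    with 3(1)[of t'] 3(4) show ?thesis
      by (simp add: root_label_add_leaf)
  next
    case (3 vs)
    with "3.IH"(2)[of vs b] "3.prems" show ?thesis
      by simp
  qed
qed auto

lemma del_leaf_idle:
  "m \<notin> set (labels t) \<Longrightarrow> del_leaf m t = t"
  "m \<notin> set (concat (map labels ts)) \<Longrightarrow> del_leaf_forest m ts = ts"
proof (induction m t and m ts rule: add_leaf_add_leaf_forest.induct)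
  case (3 m t ts)
  then show ?case
    using root_label_in_labels[of t] by auto
qed auto

lemma del_leaf_add_leaf:
  "t' \<in> set (add_leaf m t) \<Longrightarrow> m \<notin> set (labels t) \<Longrightarrow> del_leaf m t' = t"
  "us \<in> set (add_leaf_forest m ts) \<Longrightarrow> m \<notin> set (concat (map labels ts)) \<Longrightarrow> del_leaf_forest m us = ts"
proof (induction m t and m ts arbitrary: t' and us rule: add_leaf_add_leaf_forest.induct)
  case (3 m t ts)
  have "root_label t \<noteq> m"
    using 3(4) root_label_in_labels[of t] by auto
  then show ?case
    using 3 by (auto simp: del_leaf_idle root_label_add_leaf)
qed auto

lemma Cons_leaf_in_add_leaf_forest: "Node m [] # ts \<in> set (add_leaf_forest m ts)"
  by (cases ts) auto

lemma add_leaf_del_leaf: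
  "increasing t \<Longrightarrow> distinct (labels t) \<Longrightarrow> \<forall>a\<in>set (labels t). a \<le> m \<Longrightarrow> m \<in> set (labels t) \<Longrightarrow>
     root_label t \<noteq> m \<Longrightarrow> t \<in> set (add_leaf m (del_leaf m t))"
  "\<forall>t\<in>set ts. increasing t \<Longrightarrow> distinct (concat (map labels ts)) \<Longrightarrow>
     \<forall>a\<in>set (concat (map labels ts)). a \<le> m \<Longrightarrow> m \<in> set (concat (map labels ts)) \<Longrightarrow>
     ts \<in> set (add_leaf_forest m (del_leaf_forest m ts))"
proof (induction m t and m ts rule: add_leaf_add_leaf_forest.induct)
  case (1 m a ts)
  then show ?case by auto
next
  case (3 m t ts)
  show ?case
  proof (cases "root_label t = m")
    case True
    \<comment> \<open>A child would carry a label above the maximum \<open>m\<close>.\<close>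
    have "children t = []"
    proof (rule ccontr)
      assume "children t \<noteq> []"
      then obtain s where s: "s \<in> set (children t)"
        by (meson last_in_set)
      then have "m < root_label s" "root_label s \<in> set (labels t)"
        using 3(3) True by (cases t; auto)+
      with 3(5) show False by force
    qed
    then have "t = Node m []"
      using True by (cases t) simp
    moreover from this have "m \<notin> set (concat (map labels ts))"
      using 3(4) by simp
    ultimately show ?thesis
      by (simp add: del_leaf_idle Cons_leaf_in_add_leaf_forest)
  next
    case False
    show ?thesis
    proof (cases "m \<in> set (labels t)")
      case True
      then have "m \<notin> set (concat (map labels ts))"
        using 3(4) by auto
      then have "del_leaf_forest m ts = ts"
        by (rule del_leaf_idle)
      moreover have "t \<in> set (add_leaf m (del_leaf m t))"
        using 3 True False by auto
      ultimately show ?thesis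
        using False by auto
    next
      case notin: False
      have "ts \<in> set (add_leaf_forest m (del_leaf_forest m ts))"
        using 3 notin by auto
      with False show ?thesis
        by (auto simp: del_leaf_idle(1)[OF notin])
    qed
  qed
qed auto

lemma distinct_add_leaf:
  "m \<notin> set (labels t) \<Longrightarrow> distinct (add_leaf m t)"
  "m \<notin> set (concat (map labels ts)) \<Longrightarrow> distinct (add_leaf_forest m ts)"
proof (induction m t and m ts rule: add_leaf_add_leaf_forest.induct)
  case (1 m a ts)
  then show ?case by (simp add: distinct_map inj_on_def)
next
  case (3 m t ts)
  have "t \<noteq> Node m []"
    using 3(3) by auto
  \<comment> \<open>The three kinds of insertion differ in their first tree: the bare leaf,
    \<open>t\<close> with \<open>m\<close> inside, or \<open>t\<close> unchanged.\<close>
  moreover have "Node m [] \<notin> set (add_leaf m t)" "t \<notin> set (add_leaf m t)"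
    using 3(3) root_label_in_labels[of t] by (auto dest: root_label_add_leaf mset_labels_add_leaf(1))
  ultimately show ?case
    using 3 by (auto simp: distinct_map inj_on_def)
qed auto

text \<open>As an equivalence this serves both inclusions of
  \<open>increasing_plane_trees_Suc\<close>: attaching a leaf, and removing the largest one.\<close>

lemma add_leaf_in_increasing_plane_trees:
  assumes t: "t' \<in> set (add_leaf (Suc n) t)"
  shows "t' \<in> increasing_plane_trees (Suc n) \<longleftrightarrow> t \<in> increasing_plane_trees n"
proof -
  have mset: "mset (labels t') = mset (Suc n # labels t)"
    using mset_labels_add_leaf(1)[OF t] by simp
  then have "distinct (labels t') \<longleftrightarrow> Suc n \<notin> set (labels t) \<and> distinct (labels t)"
    using mset_eq_imp_distinct_iff[OF mset] by simp
  moreover have "set (labels t') = insert (Suc n) (set (labels t))"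
    using mset_eq_setD[OF mset] by simp
  moreover have "insert (Suc n) A = {1..Suc n} \<and> Suc n \<notin> A \<longleftrightarrow> A = {1..n}" for A
  proof -
    have "{1..Suc n} = insert (Suc n) {1..n}" "Suc n \<notin> {1..n}"
      by auto
    then show ?thesis
      by (metis insert_ident)
  qed
  moreover have "increasing t' \<longleftrightarrow> increasing t" if "set (labels t) = {1..n}"
    using increasing_add_leaf_iff(1)[OF t] that by auto
  ultimately show ?thesis
    unfolding increasing_plane_trees_def mem_Collect_eq by metis
qed

lemma increasing_plane_trees_Suc:
  assumes "n \<ge> 1"
  shows "increasing_plane_trees (Suc n) = (\<Union>t\<in>increasing_plane_trees n. set (add_leaf (Suc n) t))"
proof (intro equalityI subsetI)
  fix t assume t: "t \<in> increasing_plane_trees (Suc n)"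
  \<comment> \<open>The root has the smallest label, which is 1.\<close>
  have "root_label t \<noteq> Suc n"
  proof
    assume root: "root_label t = Suc n"
    have "1 \<in> set (labels t)"
      using t by (auto simp: increasing_plane_trees_def)
    moreover have "increasing t"
      using t by (simp add: increasing_plane_trees_def)
    then have "\<forall>a\<in>set (labels t). root_label t \<le> a"
    proof (induction t)
      case (Node a ts)
      then show ?case
        by (auto dest!: bspec) (meson less_imp_le order_trans)
    qed
    ultimately show False
      using root assms by auto
  qed
  then have "t \<in> set (add_leaf (Suc n) (del_leaf (Suc n) t))"
    using t by (intro add_leaf_del_leaf) (auto simp: increasing_plane_trees_def)
  with t show "t \<in> (\<Union>t\<in>increasing_plane_trees n. set (add_leaf (Suc n) t))"
    using add_leaf_in_increasing_plane_trees by blast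
qed (use add_leaf_in_increasing_plane_trees in blast)

lemma increasing_plane_trees_1: "increasing_plane_trees (Suc 0) = {Node 1 []}"
proof (intro equalityI subsetI)
  fix t assume "t \<in> increasing_plane_trees (Suc 0)"
  then have t: "distinct (labels t)" "set (labels t) = {1}"
    by (auto simp: increasing_plane_trees_def)
  then have "length (labels t) = 1"
    by (metis distinct_card card.empty card_insert_disjoint empty_iff finite.emptyI One_nat_def)
  with t show "t \<in> {Node 1 []}"
    by (cases t) (auto simp: concat_eq_Nil_conv)
qed (simp add: increasing_plane_trees_def)

lemma finite_increasing_plane_trees: "n \<ge> 1 \<Longrightarrow> finite (increasing_plane_trees n)"
  by (induction n rule: dec_induct) (simp_all add: increasing_plane_trees_1 increasing_plane_trees_Suc)

section \<open>Weights of trees and their recursion\<close>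

definition degree_weight :: "nat \<Rightarrow> int mpoly" where
  "degree_weight d = (if d \<le> 3 then elem_sym 3 (3 - d) else 0)"

lemma degree_weight_simps:
  "degree_weight 0 = var_x * var_y * var_z"
  "degree_weight 1 = var_x * var_y + var_x * var_z + var_y * var_z"
  "degree_weight 2 = var_x + var_y + var_z"
  "degree_weight 3 = 1"
  "d > 3 \<Longrightarrow> degree_weight d = 0"
proof -
  have "{S. S \<subseteq> {1..3::nat} \<and> card S = 0} = {{}}"
    by (auto dest: finite_subset)
  then show "degree_weight 3 = 1"
    by (simp add: degree_weight_def elem_sym_def)
qed (use elem_sym_3 in \<open>auto simp: degree_weight_def numeral_2_eq_2\<close>)

text \<open>In three variables the sum of the partial derivatives sends e_k to (4 - k) e_(k-1); with
  k = 3 - d the factor is d + 1. For d at least 3 both sides vanish.\<close>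

lemma stirling_deriv_degree_weight:
  "stirling_deriv (degree_weight d) = of_nat (Suc d) * degree_weight (Suc d) * degree_weight 0"
proof -
  consider "d = 0" | "d = 1" | "d = 2" | "d = 3" | "d > 3"
    by linarith
  then show ?thesis
  proof cases
    case 1
    then show ?thesis
      using degree_weight_simps by (simp add: stirling_deriv_var algebra_simps)
  next
    case 2
    then show ?thesis
      using degree_weight_simps(1-3) by (simp add: stirling_deriv_var algebra_simps numeral_2_eq_2)
  next
    case 3
    then show ?thesis
      using degree_weight_simps(1,3,4) by (simp add: stirling_deriv_var algebra_simps numeral_3_eq_3)
  qed (simp_all add: degree_weight_simps)
qed

definition tree_weight :: "plane_tree \<Rightarrow> int mpoly" where
  "tree_weight t = prod_list (map degree_weight (degrees t))"

lemma tree_weight_Node: "tree_weight (Node a ts) = degree_weight (length ts) * prod_list (map tree_weight ts)"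
proof -
  have "prod_list (map degree_weight (concat (map degrees ts))) = prod_list (map tree_weight ts)"
    by (induction ts) (simp_all add: tree_weight_def)
  then show ?thesis
    by (simp add: tree_weight_def)
qed

text \<open>In the induction over a forest, \<open>k\<close> is the number of siblings to its left.\<close>

lemma sum_list_tree_weight_add_leaf:
  "sum_list (map tree_weight (add_leaf m t)) = stirling_deriv (tree_weight t)"
  "sum_list (map (\<lambda>us. degree_weight (length us + k) * prod_list (map tree_weight us)) (add_leaf_forest m ts)) =
    of_nat (length ts + 1) * degree_weight (length ts + k + 1) * degree_weight 0 * prod_list (map tree_weight ts) +
    degree_weight (length ts + k) * stirling_deriv (prod_list (map tree_weight ts))"
proof (induction m t and m ts arbitrary: and k rule: add_leaf_add_leaf_forest.induct)
  case (1 m a ts)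
  show ?case
    \<comment> \<open>With no siblings to the left, the first summand is D of the weight of the
      parent, and the product rule merges the two summands.\<close>
    using 1[of 0] by (simp add: tree_weight_Node stirling_deriv_degree_weight o_def algebra_simps)
next
  case (2 m)
  show ?case by (simp add: tree_weight_Node)
next
  case (3 m t ts)
  show ?case
    \<comment> \<open>Moving past \<open>t\<close> adds one left sibling.\<close>
    using 3(2)[of "Suc k"]
    by (simp add: 3(1) tree_weight_Node o_def sum_list_const_mult sum_list_mult_const mult.assoc algebra_simps)
qed

lemma sum_tree_weight_1: "(\<Sum>t\<in>increasing_plane_trees (Suc 0). tree_weight t) = var_x * var_y * var_z"
  by (simp add: increasing_plane_trees_1 tree_weight_Node degree_weight_simps)

lemma sum_tree_weight_Suc:
  assumes "n \<ge> 1"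
  shows "(\<Sum>t\<in>increasing_plane_trees (Suc n). tree_weight t) =
    stirling_deriv (\<Sum>t\<in>increasing_plane_trees n. tree_weight t)"
proof -
  have notin: "Suc n \<notin> set (labels t)" if "t \<in> increasing_plane_trees n" for t
    using that by (auto simp: increasing_plane_trees_def)
  have "(\<Sum>t\<in>increasing_plane_trees (Suc n). tree_weight t) =
    (\<Sum>t\<in>increasing_plane_trees n. \<Sum>t'\<in>set (add_leaf (Suc n) t). tree_weight t')"
    unfolding increasing_plane_trees_Suc[OF assms]
  proof (intro sum.UNION_disjoint ballI impI)
    fix s t assume "s \<in> increasing_plane_trees n" "t \<in> increasing_plane_trees n" "s \<noteq> t"
    then show "set (add_leaf (Suc n) s) \<inter> set (add_leaf (Suc n) t) = {}"
      using del_leaf_add_leaf(1) notin by blast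
  qed (use finite_increasing_plane_trees[OF assms] in simp_all)
  also have "\<dots> = (\<Sum>t\<in>increasing_plane_trees n. stirling_deriv (tree_weight t))"
    by (intro sum.cong refl)
      (simp add: sum_list_tree_weight_add_leaf(1) distinct_add_leaf(1) notin flip: sum_list_distinct_conv_sum_set)
  finally show ?thesis
    by (simp add: stirling_deriv_sum)
qed

section \<open>Sorting trees by their degree counts\<close>

lemma length_degrees: "length (degrees t) = length (labels t)"
  by (induction t) (simp add: length_concat o_def cong: map_cong)

text \<open>Every vertex except the root is a child of exactly one vertex.\<close>

lemma sum_list_degrees: "sum_list (degrees t) + 1 = length (degrees t)"
proof (induction t)
  case (Node a ts)
  then have "sum_list (concat (map degrees ts)) + length ts = length (concat (map degrees ts))"
  proof (induction ts)
    case (Cons t ts)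
    from Cons.prems[of t] Cons.IH Cons.prems show ?case by fastforce
  qed simp
  then show ?case by simp
qed

lemma prod_list_degree_weight:
  assumes "\<forall>d\<in>set ds. d \<le> 3"
  shows "prod_list (map degree_weight ds) =
    degree_weight 2 ^ count_list ds 2 * degree_weight 1 ^ count_list ds 1 * degree_weight 0 ^ count_list ds 0"
  using assms
proof (induction ds)
  case (Cons d ds)
  then have "d = 0 \<or> d = 1 \<or> d = 2 \<or> d = 3"
    by auto
  with Cons show ?case
    using degree_weight_simps(4) by (auto simp: mult_ac)
qed simp

text \<open>A vertex of degree d contributes (3 - d) + d = 3.\<close>

lemma count_list_degrees:
  assumes "\<forall>d\<in>set ds. d \<le> 3"
  shows "count_list ds 2 + 2 * count_list ds 1 + 3 * count_list ds 0 + sum_list ds = 3 * length ds"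
  using assms
proof (induction ds)
  case (Cons d ds)
  then have "d = 0 \<or> d = 1 \<or> d = 2 \<or> d = 3"
    by auto
  with Cons show ?case by auto
qed simp

lemma sum_tree_weight_gamma:
  assumes "n \<ge> 1"
  shows "(\<Sum>t\<in>increasing_plane_trees n. tree_weight t) =
    (\<Sum>(i, j, k) \<in> {(i, j, k). i + 2 * j + 3 * k = 2 * n + 1}.
       of_nat (gamma n i j k) * degree_weight 2 ^ i * degree_weight 1 ^ j * degree_weight 0 ^ k)"
proof -
  let ?h = "\<lambda>t. (count_list (degrees t) 2, count_list (degrees t) 1, count_list (degrees t) 0)"
  let ?S = "{(i, j, k). i + 2 * j + 3 * k = 2 * n + 1}"
  let ?w = "\<lambda>(i, j, k). degree_weight 2 ^ i * degree_weight 1 ^ j * degree_weight 0 ^ k"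
  have fin: "finite (trees_0123 n)"
    using finite_increasing_plane_trees[OF assms] by (simp add: trees_0123_def)
  have "?S \<subseteq> {..2 * n + 1} \<times> {..2 * n + 1} \<times> {..2 * n + 1}"
    by auto
  then have fin_S: "finite ?S"
    by (rule finite_subset) simp
  \<comment> \<open>The degrees sum to n - 1, so i + 2j + 3k = 3n - (n - 1) = 2n + 1.\<close>
  have "?h t \<in> ?S" if "t \<in> trees_0123 n" for t
  proof -
    have t: "distinct (labels t)" "set (labels t) = {1..n}" "\<forall>d\<in>set (degrees t). d \<le> 3"
      using that by (auto simp: trees_0123_def increasing_plane_trees_def)
    then have "length (degrees t) = n"
      by (metis length_degrees distinct_card card_atLeastAtMost diff_Suc_1)
    then show ?thesis
      using count_list_degrees[OF t(3)] sum_list_degrees[of t] by simp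
  qed
  then have h: "?h ` trees_0123 n \<subseteq> ?S"
    by blast
  \<comment> \<open>A vertex of degree above 3 has weight 0 and so kills the weight of its
    tree.\<close>
  have "(\<Sum>t\<in>increasing_plane_trees n. tree_weight t) = (\<Sum>t\<in>trees_0123 n. tree_weight t)"
  proof (rule sum.mono_neutral_right)
    show "\<forall>t\<in>increasing_plane_trees n - trees_0123 n. tree_weight t = 0"
    proof
      fix t assume "t \<in> increasing_plane_trees n - trees_0123 n"
      then obtain d where "d \<in> set (degrees t)" "d > 3"
        by (auto simp: trees_0123_def not_le)
      then have "0 \<in> set (map degree_weight (degrees t))"
        using degree_weight_simps(5) by force
      then show "tree_weight t = 0"
        by (simp add: tree_weight_def prod_list_zero_iff)
    qed
  qed (use finite_increasing_plane_trees[OF assms] in \<open>auto simp: trees_0123_def\<close>)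
  also have "\<dots> = (\<Sum>t\<in>trees_0123 n. ?w (?h t))"
    by (intro sum.cong) (auto simp: tree_weight_def prod_list_degree_weight trees_0123_def)
  also have "\<dots> = (\<Sum>x\<in>?S. \<Sum>t\<in>{t \<in> trees_0123 n. ?h t = x}. ?w (?h t))"
    by (rule sum.group[OF fin fin_S h, symmetric])
  also have "\<dots> = (\<Sum>(i, j, k)\<in>?S. of_nat (gamma n i j k) * degree_weight 2 ^ i * degree_weight 1 ^ j * degree_weight 0 ^ k)"
  proof (intro sum.cong refl)
    fix x :: "nat \<times> nat \<times> nat" assume "x \<in> ?S"
    obtain i j k where x: "x = (i, j, k)"
      by (cases x)
    have "{t \<in> trees_0123 n. ?h t = x} = {t \<in> trees_0123 n. count_list (degrees t) 0 = k \<and>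
             count_list (degrees t) 1 = j \<and> count_list (degrees t) 2 = i}"
      by (auto simp: x)
    then have "card {t \<in> trees_0123 n. ?h t = x} = gamma n i j k"
      by (simp add: gamma_def)
    then show "(\<Sum>t\<in>{t \<in> trees_0123 n. ?h t = x}. ?w (?h t)) =
      (case x of (i, j, k) \<Rightarrow> of_nat (gamma n i j k) * degree_weight 2 ^ i * degree_weight 1 ^ j * degree_weight 0 ^ k)"
      by (simp add: x mult.assoc)
  qed
  finally show ?thesis .
qed

section \<open>The expansion and e-positivity\<close>

lemma var_power_conv_single: "var i ^ k = Poly_Mapping.single (Poly_Mapping.single i k) 1"
  by (induction k) (simp_all add: var_def mult_single flip: single_add)

theorem theorem4p1:
  fixes n :: nat
  assumes "n \<ge> 1"
  shows "stirling_poly n =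
      (\<Sum>(i, j, k) \<in> {(i, j, k). i + 2 * j + 3 * k = 2 * n + 1}.
         of_nat (gamma n i j k) *
         (var_x + var_y + var_z) ^ i *
         (var_x * var_y + var_x * var_z + var_y * var_z) ^ j *
         (var_x * var_y * var_z) ^ k)
    \<and> e_positive 3 (stirling_poly n)"
proof
  let ?S = "{(i, j, k). i + 2 * j + 3 * k = 2 * n + 1}"
  have "stirling_poly n = (\<Sum>t\<in>increasing_plane_trees n. tree_weight t)"
    using assms
  proof (induction n rule: dec_induct)
    case base
    show ?case by (simp add: stirling_poly_1 sum_tree_weight_1)
  next
    case (step n)
    then show ?case by (simp add: stirling_poly_Suc sum_tree_weight_Suc)
  qed
  then show expansion: "stirling_poly n = (\<Sum>(i, j, k) \<in> ?S. of_nat (gamma n i j k) *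
      (var_x + var_y + var_z) ^ i * (var_x * var_y + var_x * var_z + var_y * var_z) ^ j *
      (var_x * var_y * var_z) ^ k)"
    using sum_tree_weight_gamma[OF assms] by (simp only: degree_weight_simps)
  \<comment> \<open>The witness is the expansion with e_1, e_2, e_3 replaced by the variables 1, 2,
    3.\<close>
  define q where "q = (\<Sum>(i, j, k) \<in> ?S. of_nat (gamma n i j k) * var 1 ^ i * var 2 ^ j * var 3 ^ k)"
  \<comment> \<open>Written as a sum of single terms with coefficients from \<open>gamma\<close>,
    \<open>q\<close> visibly has nonnegative coefficients and only the variables 1, 2, 3.\<close>
  have q: "q = (\<Sum>(i, j, k) \<in> ?S. Poly_Mapping.single
    (Poly_Mapping.single 1 i + Poly_Mapping.single 2 j + Poly_Mapping.single 3 k) (int (gamma n i j k)))"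
    unfolding q_def single_of_nat[symmetric] var_power_conv_single mult_single by simp
  have "e_positive 3 (subst_vars (elem_sym 3) q)"
  proof (rule e_positiveI)
    show "in_vars {1..3} q"
      unfolding q case_prod_unfold
      by (intro in_vars_sum in_vars_single order.trans[OF keys_add] Un_least) auto
    show "Poly_Mapping.lookup q m \<ge> 0" for m
      unfolding q lookup_sum by (intro sum_nonneg) (auto simp: lookup_single when_def)
  qed
  also have "subst_vars (elem_sym 3) q = stirling_poly n"
    unfolding expansion q_def elem_sym_3[symmetric] by (simp add: case_prod_unfold del: One_nat_def)
  finally show "e_positive 3 (stirling_poly n)" .
qed

end
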